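(* Let $X$ be a real normed space and let $\mathcal C,\mathcal K\subset X$ be co-radiant sets such that $d_{\mathcal C}d_{\mathcal K}>0$, $\mathcal K$ is regular, $\operatorname{cl\,co}(\mathcal C)\cap\operatorname{int}(\mathcal K)\ne\varnothing$, and $(\operatorname{cone}(\mathcal C),\operatorname{cone}(\mathcal K))$ verifies the SSP. Let $0<\alpha_1<\alpha_2<1$, $f\in S_{X^*}$, $\lambda>0$ and $\eta_0>0$ be such that, for every $0<\theta<1$, every $\eta\in(0,\theta\eta_0)$ and every $\alpha\in(\alpha_1,\alpha_2)$, $$f(y')-\alpha\|y'\|<\lambda\theta<\lambda<f(y)-\alpha\|y\|\qquad\forall y'\in X\setminus\operatorname{int}(\mathcal K(\eta)),\ \forall y\in\operatorname{cl\,co}(\mathcal C).$$ Fix $\alpha\in(\alpha_1,\alpha_2)$ and set $p_\alpha(y):=f(y)-\alpha\|y\|$ and $G_\alpha(y):=(\lambda-p_\alpha(y))_+$ for $y\in X$. Then: (i) For every $y\in X\setminus\{0_X\}$, $$\bigl(\eta_0-\delta_{\mathcal K}(y)\bigr)_+\le\frac{\eta_0}{\lambda}\,G_\alpha(y).$$ (ii) For every $y\in X$, $$\operatorname{dist}(y,F_\alpha)\le\frac{2}{1-\alpha}\,G_\alpha(y),\qquad\text{where } F_\alpha:=\{y\in X:\ p_\alpha(y)\ge\lambda\}=\{y\in X:\ G_\alpha(y)=0\}.$$ Moreover, every $y\in F_\alpha$ satisfies $\delta_{\mathcal K}(y)\ge\eta_0$.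
   Context: $X$ is a real normed space, $S_X$ its unit sphere, $B_X^\circ$ its open unit ball, $X^*$ its topological dual, $S_{X^*}$ the unit sphere of $X^*$ for the dual norm; $\operatorname{cl},\operatorname{int},\operatorname{bd},\operatorname{co}$ denote closure, interior, boundary, convex hull, and $\operatorname{cl\,co}$ the closed convex hull; $t_+:=\max\{t,0\}$; $\operatorname{dist}(x,A):=\inf_{a\in A}\|x-a\|$. A cone is a nonempty $C\subset X$ with $\alpha C\subset C$ for all $\alpha\ge 0$; cones are assumed nontrivial ($\{0_X\}\subsetneq C\subset X$) unless otherwise stated. $\operatorname{cone}(A):=\{\lambda a:\lambda\ge 0,\ a\in A\}$. SSP: a pair of cones $(C,K)$ verifies the strict separation property (SSP) if $0_X\notin\operatorname{cl}\bigl(\operatorname{co}(C\cap S_X)-\operatorname{co}((\operatorname{bd}K\cap S_X)\cup\{0_X\})\bigr)$. Co-radiant set: $\mathcal K\subset X$ with $\lambda x\in\mathcal K$ for all $x\in\mathcal K$, $\lambda\ge 1$; co-radiant sets are assumed nonempty with $0_X\notin\mathcal K$. For $\eta>0$, $\mathcal K(\eta):=\eta\mathcal K$. Norm-base: for $t>0$, $\mathcal K\cap tS_X$ is a norm-base of $\mathcal K$ if for every $x\in\mathcal K$ there exist $y\in\mathcal K\cap tS_X$ and $\lambda>0$ with $x=\lambda y$; $\mathcal K$ admits a norm-base if this holds for some $t>0$. Interior reductions: for a cone $K$ and $\varepsilon>0$, $K^{-\varepsilon}:=K\setminus\bigl(\operatorname{cone}((\operatorname{bd}K\cap S_X)+\varepsilon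 B_X^\circ)\setminus\{0_X\}\bigr)$. For co-radiant $\mathcal K$, $\mathcal K^{-\varepsilon}:=\mathcal K\cap(\operatorname{cone}(\mathcal K))^{-\varepsilon}$. $\mathcal K$ is regular if, for every $\varepsilon>0$ with $\mathcal K^{-\varepsilon}\neq\varnothing$, the set $\mathcal K^{-\varepsilon}$ admits a norm-base. Radial profile: $\rho_{\mathcal K}:S_X\to[0,+\infty]$, $\rho_{\mathcal K}(v):=\inf\{\lambda>0:\lambda v\in\mathcal K\}$ with $\inf\varnothing=+\infty$; $\operatorname{dom}(\rho_{\mathcal K}):=\{v\in S_X:\rho_{\mathcal K}(v)<+\infty\}$; $d_{\mathcal K}:=\inf_{v\in\operatorname{dom}(\rho_{\mathcal K})}\rho_{\mathcal K}(v)$. Radial depth: $\delta_{\mathcal K}:X\setminus\{0_X\}\to[0,+\infty]$, $\delta_{\mathcal K}(y):=\sup\{\eta>0:\ y\in\mathcal K(\eta)\}$ with $\sup\varnothing=0$. *)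

theory Defs
  imports "HOL-Analysis.Analysis"
begin

text \<open>The cone generated by \<open>A\<close>, that is \<open>{c *\<^sub>R a | c a. 0 \<le> c \<and> a \<in> A}\<close>, is the library's
  \<open>cone hull A\<close> (see \<open>cone_hull_expl\<close>).\<close>

definition co_radiant :: "'a::real_normed_vector set \<Rightarrow> bool" where
  "co_radiant K \<longleftrightarrow> K \<noteq> {} \<and> 0 \<notin> K \<and> (\<forall>x\<in>K. \<forall>c\<ge>1. c *\<^sub>R x \<in> K)"

text \<open>The strict separation property is meant for nontrivial cones; the cones generated by
  co-radiant sets always are.\<close>

lemma co_radiant_cone_hull:
  assumes "co_radiant K"
  shows "cone (cone hull K)" and "{0} \<subset> cone hull K"
proof -
  show "cone (cone hull K)" by (rule cone_cone_hull)
  obtain x where x: "x \<in> K" "x \<noteq> 0" using assms by (auto simp: co_radiant_def)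
  have "x \<in> cone hull K" using x(1) by (rule hull_inc)
  moreover have "0 \<in> cone hull K" using x(1) cone_hull_contains_0[of K] by auto
  ultimately show "{0} \<subset> cone hull K" using x(2) by auto
qed

text \<open>On sets, infix minus is set difference, so the algebraic difference is written out.\<close>

definition SSP :: "'a::real_normed_vector set \<Rightarrow> 'a set \<Rightarrow> bool" where
  "SSP C K \<longleftrightarrow>
     0 \<notin> closure {x - y | x y. x \<in> convex hull (C \<inter> sphere 0 1) \<and>
                                y \<in> convex hull ((frontier K \<inter> sphere 0 1) \<union> {0})}"

definition dilate :: "real \<Rightarrow> 'a::real_normed_vector set \<Rightarrow> 'a set" where
  "dilate \<eta> K = (\<lambda>x. \<eta> *\<^sub>R x) ` K"

definition is_norm_base :: "real \<Rightarrow> 'a::real_normed_vector set \<Rightarrow> bool" where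
  "is_norm_base t K \<longleftrightarrow> (\<forall>x\<in>K. \<exists>y\<in>K \<inter> sphere 0 t. \<exists>c>0. x = c *\<^sub>R y)"

definition admits_norm_base :: "'a::real_normed_vector set \<Rightarrow> bool" where
  "admits_norm_base K \<longleftrightarrow> (\<exists>t>0. is_norm_base t K)"

definition cone_reduction :: "real \<Rightarrow> 'a::real_normed_vector set \<Rightarrow> 'a set" where
  "cone_reduction \<epsilon> K =
     K - (cone hull {x + \<epsilon> *\<^sub>R b | x b. x \<in> frontier K \<inter> sphere 0 1 \<and> b \<in> ball 0 1} - {0})"

definition co_radiant_reduction :: "real \<Rightarrow> 'a::real_normed_vector set \<Rightarrow> 'a set" where
  "co_radiant_reduction \<epsilon> K = K \<inter> cone_reduction \<epsilon> (cone hull K)"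

definition regular_co_radiant :: "'a::real_normed_vector set \<Rightarrow> bool" where
  "regular_co_radiant K \<longleftrightarrow>
     (\<forall>\<epsilon>>0. co_radiant_reduction \<epsilon> K \<noteq> {} \<longrightarrow> admits_norm_base (co_radiant_reduction \<epsilon> K))"

text \<open>The values of the next three functions lie in \<open>[0, \<infinity>]\<close>, where \<open>Inf {} = \<infinity>\<close> and
  \<open>Sup {} = 0\<close>. The radial profile is meant on the unit sphere only, the radial depth on
  nonzero vectors only.\<close>

definition radial_profile :: "'a::real_normed_vector set \<Rightarrow> 'a \<Rightarrow> ennreal" where
  "radial_profile K v = (INF c\<in>{c. 0 < c \<and> c *\<^sub>R v \<in> K}. ennreal c)"

definition dom_profile :: "'a::real_normed_vector set \<Rightarrow> 'a set" where
  "dom_profile K = {v \<in> sphere 0 1. radial_profile K v < \<infinity>}"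

definition inf_profile :: "'a::real_normed_vector set \<Rightarrow> ennreal" where
  "inf_profile K = (INF v\<in>dom_profile K. radial_profile K v)"

definition radial_depth :: "'a::real_normed_vector set \<Rightarrow> 'a \<Rightarrow> ennreal" where
  "radial_depth K y = (SUP \<eta>\<in>{\<eta>. 0 < \<eta> \<and> y \<in> dilate \<eta> K}. ennreal \<eta>)"

definition p_fun :: "('a::real_normed_vector \<Rightarrow>\<^sub>L real) \<Rightarrow> real \<Rightarrow> 'a \<Rightarrow> real" where
  "p_fun f \<alpha> y = blinfun_apply f y - \<alpha> * norm y"

definition G_fun :: "('a::real_normed_vector \<Rightarrow>\<^sub>L real) \<Rightarrow> real \<Rightarrow> real \<Rightarrow> 'a \<Rightarrow> real" where
  "G_fun f lam \<alpha> y = max (lam - p_fun f \<alpha> y) 0"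

definition F_set :: "('a::real_normed_vector \<Rightarrow>\<^sub>L real) \<Rightarrow> real \<Rightarrow> real \<Rightarrow> 'a set" where
  "F_set f lam \<alpha> = {y. p_fun f \<alpha> y \<ge> lam}"

end

theory Submission
  imports Defs
begin

text \<open>The separation hypothesis says that \<^term>\<open>p_fun f \<alpha>\<close> is below \<^term>\<open>lam * \<theta>\<close> off the
  dilate \<^term>\<open>dilate \<eta> K\<close> whenever \<open>\<eta> < \<theta> * \<eta>\<^sub>0\<close>. Letting \<open>\<theta>\<close> decrease to \<open>\<eta> / \<eta>\<^sub>0\<close> and reading this
  contrapositively, a point \<open>y\<close> lies in every dilate with \<open>\<eta>\<close> below both \<open>\<eta>\<^sub>0\<close> and
  \<open>\<eta>\<^sub>0 / lam * p_fun f \<alpha> y\<close>. The radial depth of \<open>y\<close> is therefore at least the smaller of these two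
  numbers (\<open>radial_depth_ge_of_separation\<close>). The estimate (i) is this bound subtracted from \<open>\<eta>\<^sub>0\<close>,
  and on the set where \<open>p_fun f \<alpha> y\<close> is at least \<open>lam\<close> the smaller number is \<open>\<eta>\<^sub>0\<close> itself.

  The estimate (ii) is an error bound for a superlevel set of \<^term>\<open>p_fun f \<alpha>\<close>. As \<open>f\<close> has norm one
  and \<open>\<alpha> < 1\<close>, some unit direction makes \<open>f\<close> grow at rate at least \<open>(1 + \<alpha>) / 2\<close>, while
  \<open>\<alpha> * norm\<close> grows at rate at most \<open>\<alpha>\<close>. Along it \<^term>\<open>p_fun f \<alpha>\<close> grows at rate at least
  \<open>(1 - \<alpha>) / 2\<close> from every starting point, so a walk of length \<open>2 / (1 - \<alpha>)\<close> times the deficit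
  reaches the set (\<open>infdist_superlevel_le\<close>).\<close>

lemma radial_depth_ge:
  assumes "\<And>\<eta>. \<lbrakk>0 < \<eta>; \<eta> < b\<rbrakk> \<Longrightarrow> y \<in> dilate \<eta> K"
  shows "ennreal b \<le> radial_depth K y"
proof (rule dense_le)
  fix a assume a: "a < ennreal b"
  then obtain r where r: "a = ennreal r" "0 \<le> r"
    by (cases a) auto
  with a have rb: "r < b"
    by (simp add: ennreal_less_iff)
  define \<eta> where "\<eta> = (r + b) / 2"
  have \<eta>: "0 < \<eta>" "\<eta> < b" "r \<le> \<eta>"
    using r(2) rb by (auto simp: \<eta>_def)
  have "a \<le> ennreal \<eta>"
    using \<eta>(3) r(1) by (simp add: ennreal_leI)
  also have "\<dots> \<le> radial_depth K y"
    unfolding radial_depth_def using assms \<eta> by (intro SUP_upper) auto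
  finally show "a \<le> radial_depth K y" .
qed

lemma radial_depth_ge_of_separation:
  fixes f :: "'a::real_normed_vector \<Rightarrow>\<^sub>L real"
  assumes pos: "0 < lam" "0 < \<eta>\<^sub>0"
    and sep: "\<And>\<theta> \<eta> y'. \<lbrakk>0 < \<theta>; \<theta> < 1; 0 < \<eta>; \<eta> < \<theta> * \<eta>\<^sub>0; y' \<notin> interior (dilate \<eta> K)\<rbrakk>
                \<Longrightarrow> p_fun f \<alpha> y' < lam * \<theta>"
  shows "ennreal (min \<eta>\<^sub>0 (\<eta>\<^sub>0 / lam * p_fun f \<alpha> y)) \<le> radial_depth K y"
proof (rule radial_depth_ge)
  fix \<eta> assume \<eta>: "0 < \<eta>" "\<eta> < min \<eta>\<^sub>0 (\<eta>\<^sub>0 / lam * p_fun f \<alpha> y)"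
  \<comment> \<open>Some \<open>\<theta>\<close> strictly between \<open>\<eta> / \<eta>\<^sub>0\<close> and \<open>1\<close> still satisfies \<open>lam * \<theta> \<le> p_fun f \<alpha> y\<close>.\<close>
  define \<theta> where "\<theta> = min (p_fun f \<alpha> y / lam) ((1 + \<eta> / \<eta>\<^sub>0) / 2)"
  have low: "\<eta> / \<eta>\<^sub>0 < \<theta>"
    using \<eta> pos by (auto simp: \<theta>_def field_simps)
  have "0 < \<eta> / \<eta>\<^sub>0"
    using \<eta>(1) pos by simp
  then have \<theta>0: "0 < \<theta>"
    using low by linarith
  have "\<eta> / \<eta>\<^sub>0 < 1"
    using \<eta> pos by simp
  then have \<theta>1: "\<theta> < 1"
    by (simp add: \<theta>_def min_less_iff_disj)
  have less: "\<eta> < \<theta> * \<eta>\<^sub>0"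
    using low pos by (simp add: field_simps)
  have "\<theta> \<le> p_fun f \<alpha> y / lam"
    by (simp add: \<theta>_def)
  then have "lam * \<theta> \<le> p_fun f \<alpha> y"
    using pos by (simp add: field_simps)
  then have "y \<in> interior (dilate \<eta> K)"
    using sep[OF \<theta>0 \<theta>1 \<eta>(1) less] by force
  then show "y \<in> dilate \<eta> K"
    using interior_subset by blast
qed

text \<open>The norm of a functional need not be attained, so only a rate below it can be asked for.\<close>

lemma blinfun_unit_direction:
  fixes f :: "'a::real_normed_vector \<Rightarrow>\<^sub>L real"
  assumes "0 \<le> c" "c < norm f"
  obtains u where "norm u = 1" "c < blinfun_apply f u"
proof -
  obtain x where x: "c * norm x < \<bar>blinfun_apply f x\<bar>"
    using norm_blinfun_bound[of c f] assms by (metis not_less real_norm_def)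
  have "x \<noteq> 0"
    using x by (auto simp: blinfun.zero_right)
  define u where "u = (sgn (blinfun_apply f x) / norm x) *\<^sub>R x"
  have "blinfun_apply f u = \<bar>blinfun_apply f x\<bar> / norm x"
    by (simp add: u_def blinfun.scaleR_right sgn_real_def)
  then have "c < blinfun_apply f u"
    using x \<open>x \<noteq> 0\<close> by (simp add: pos_less_divide_eq)
  moreover have "blinfun_apply f x \<noteq> 0"
    using x assms(1) by (smt (verit) mult_nonneg_nonneg norm_ge_zero)
  then have "norm u = 1"
    using \<open>x \<noteq> 0\<close> by (simp add: u_def sgn_real_def)
  ultimately show thesis
    using that by blast
qed

lemma p_fun_step_ge:
  assumes "0 \<le> \<alpha>" "0 \<le> t" "norm u = 1" "c \<le> blinfun_apply f u"
  shows "p_fun f \<alpha> y + t * (c - \<alpha>) \<le> p_fun f \<alpha> (y + t *\<^sub>R u)"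
proof -
  have "norm (y + t *\<^sub>R u) \<le> norm y + t"
    using norm_triangle_ineq[of y "t *\<^sub>R u"] assms by simp
  then have "\<alpha> * norm (y + t *\<^sub>R u) \<le> \<alpha> * norm y + \<alpha> * t"
    using mult_left_mono[OF _ assms(1)] by (simp flip: distrib_left)
  moreover have "t * c \<le> t * blinfun_apply f u"
    using assms by (simp add: mult_left_mono)
  ultimately show ?thesis
    by (simp add: p_fun_def blinfun.add_right blinfun.scaleR_right algebra_simps)
qed

lemma infdist_superlevel_le:
  assumes "norm f = 1" "0 \<le> \<alpha>" "\<alpha> < 1"
  shows "infdist y (F_set f lam \<alpha>) \<le> 2 / (1 - \<alpha>) * G_fun f lam \<alpha> y"
proof -
  \<comment> \<open>The midpoint of \<open>\<alpha>\<close> and \<open>norm f\<close> is a rate that some direction attains; its excess over \<open>\<alpha>\<close>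
    is \<open>(1 - \<alpha>) / 2\<close>, whence the constant.\<close>
  obtain u where u: "norm u = 1" "(1 + \<alpha>) / 2 < blinfun_apply f u"
    using blinfun_unit_direction[of "(1 + \<alpha>) / 2" f] assms by auto
  define t where "t = 2 / (1 - \<alpha>) * G_fun f lam \<alpha> y"
  have t: "0 \<le> t"
    using assms by (simp add: t_def G_fun_def)
  have "t * ((1 + \<alpha>) / 2 - \<alpha>) = G_fun f lam \<alpha> y"
    using assms by (simp add: t_def field_simps)
  then have "p_fun f \<alpha> y + G_fun f lam \<alpha> y \<le> p_fun f \<alpha> (y + t *\<^sub>R u)"
    using p_fun_step_ge[OF assms(2) t u(1) less_imp_le[OF u(2)], of y] by simp
  then have "y + t *\<^sub>R u \<in> F_set f lam \<alpha>"
    by (simp add: F_set_def G_fun_def)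
  then have "infdist y (F_set f lam \<alpha>) \<le> dist y (y + t *\<^sub>R u)"
    by (rule infdist_le)
  also have "\<dots> = t"
    using t u by (simp add: dist_norm)
  finally show ?thesis
    by (simp add: t_def)
qed

theorem proposition7p7:
  fixes C K :: "'a::real_normed_vector set"
    and f :: "'a \<Rightarrow>\<^sub>L real"
    and \<alpha>\<^sub>1 \<alpha>\<^sub>2 lam \<eta>\<^sub>0 \<alpha> :: real
  assumes "co_radiant C" and "co_radiant K"
    and "inf_profile C * inf_profile K > 0"
    and "regular_co_radiant K"
    and "closure (convex hull C) \<inter> interior K \<noteq> {}"
    and "SSP (cone hull C) (cone hull K)"
    and "0 < \<alpha>\<^sub>1" and "\<alpha>\<^sub>1 < \<alpha>\<^sub>2" and "\<alpha>\<^sub>2 < 1"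
    and "norm f = 1" and "lam > 0" and "\<eta>\<^sub>0 > 0"
    and "\<And>\<theta> \<eta> \<beta> y' y.
           \<lbrakk>0 < \<theta>; \<theta> < 1; \<eta> \<in> {0<..<\<theta> * \<eta>\<^sub>0}; \<beta> \<in> {\<alpha>\<^sub>1<..<\<alpha>\<^sub>2};
            y' \<in> UNIV - interior (dilate \<eta> K); y \<in> closure (convex hull C)\<rbrakk>
           \<Longrightarrow> blinfun_apply f y' - \<beta> * norm y' < lam * \<theta> \<and> lam * \<theta> < lam \<and>
               lam < blinfun_apply f y - \<beta> * norm y"
    and "\<alpha> \<in> {\<alpha>\<^sub>1<..<\<alpha>\<^sub>2}"
  shows "(\<forall>y. y \<noteq> 0 \<longrightarrow>
            max (ereal \<eta>\<^sub>0 - enn2ereal (radial_depth K y)) 0 \<le> ereal (\<eta>\<^sub>0 / lam * G_fun f lam \<alpha> y))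
       \<and> F_set f lam \<alpha> = {y. G_fun f lam \<alpha> y = 0}
       \<and> (\<forall>y. infdist y (F_set f lam \<alpha>) \<le> 2 / (1 - \<alpha>) * G_fun f lam \<alpha> y)
       \<and> (\<forall>y\<in>F_set f lam \<alpha>. ennreal \<eta>\<^sub>0 \<le> radial_depth K y)"
proof -
  \<comment> \<open>The separation hypothesis also quantifies over a point of the closed convex hull of \<open>C\<close>; any one
    serves to extract the bound off the dilates.\<close>
  obtain y0 where y0: "y0 \<in> closure (convex hull C)"
    using assms(5) by blast
  have depth: "ennreal (min \<eta>\<^sub>0 (\<eta>\<^sub>0 / lam * p_fun f \<alpha> y)) \<le> radial_depth K y" for y
  proof (rule radial_depth_ge_of_separation)
    show "p_fun f \<alpha> y' < lam * \<theta>"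
      if "0 < \<theta>" "\<theta> < 1" "0 < \<eta>" "\<eta> < \<theta> * \<eta>\<^sub>0" "y' \<notin> interior (dilate \<eta> K)" for \<theta> \<eta> y'
      using assms(13)[of \<theta> \<eta> \<alpha> y' y0] assms(14) that y0 by (simp add: p_fun_def)
  qed (use assms in auto)
  have "max (ereal \<eta>\<^sub>0 - enn2ereal (radial_depth K y)) 0 \<le> ereal (\<eta>\<^sub>0 / lam * G_fun f lam \<alpha> y)"
    for y
  proof -
    let ?b = "min \<eta>\<^sub>0 (\<eta>\<^sub>0 / lam * p_fun f \<alpha> y)"
    have scaled: "\<eta>\<^sub>0 / lam * G_fun f lam \<alpha> y = max (\<eta>\<^sub>0 - \<eta>\<^sub>0 / lam * p_fun f \<alpha> y) 0"
      using assms(11,12) by (auto simp: G_fun_def max_def field_simps)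
    have "ereal (max 0 ?b) = enn2ereal (ennreal ?b)"
      by (simp add: ennreal.rep_eq sup_max ereal_max zero_ereal_def)
    also have "\<dots> \<le> enn2ereal (radial_depth K y)"
      using depth by (simp add: less_eq_ennreal.rep_eq)
    finally have "ereal \<eta>\<^sub>0 - enn2ereal (radial_depth K y) \<le> ereal \<eta>\<^sub>0 - ereal (max 0 ?b)"
      by (rule ereal_minus_mono[OF order_refl])
    also have "\<dots> \<le> ereal (max (\<eta>\<^sub>0 - \<eta>\<^sub>0 / lam * p_fun f \<alpha> y) 0)"
      unfolding ereal_minus ereal_less_eq using assms(12) by linarith
    finally show ?thesis
      unfolding scaled by (simp add: max_def)
  qed
  moreover have "F_set f lam \<alpha> = {y. G_fun f lam \<alpha> y = 0}"
    by (auto simp: F_set_def G_fun_def)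
  moreover have "infdist y (F_set f lam \<alpha>) \<le> 2 / (1 - \<alpha>) * G_fun f lam \<alpha> y" for y
    using assms by (intro infdist_superlevel_le) auto
  moreover have "ennreal \<eta>\<^sub>0 \<le> radial_depth K y" if "y \<in> F_set f lam \<alpha>" for y
  proof -
    have "\<eta>\<^sub>0 \<le> \<eta>\<^sub>0 / lam * p_fun f \<alpha> y"
      using that assms(11,12) by (simp add: F_set_def field_simps)
    then show ?thesis
      using depth[of y] by (simp add: min_absorb1)
  qed
  ultimately show ?thesis
    by blast
qed

end
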